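(* Let $k\ge 1$ be an integer, let $0<\epsilon<1$, and let $m=\lfloor\epsilon^{-2}\rfloor$. Suppose $m\ge2$ and that there is a conference matrix in $M_m(\mathbb{C})$; let $C_m\in M_m(\mathbb{C})$ be a conference matrix. Let $U$ be the cyclic left shift on $\mathbb{C}^k$, let $F_m$ be the $m\times m$ Fourier matrix, and define matrices in $M_k(\mathbb{C})\otimes M_m(\mathbb{C})\cong M_{km}(\mathbb{C})$ by $$A^{(j)}=U^j\otimes F_m\quad (j\in[k-1]),\qquad A^{(k)}=\frac{I\otimes C_m}{\sqrt{m-1}}.$$ If $X_1\amalg\cdots\amalg X_r=[km]$ is a partition into nonempty sets such that $$\|P_{X_i}A^{(j)}P_{X_i}\|<\epsilon\qquad\text{for all } i\in[r],\ j\in[k],$$ then all the $X_i$ are singletons. Consequently, if $(A^{(1)},\dots,A^{(k)})$ can be jointly $(r,\epsilon)$ paved, then $r\ge k\lfloor\epsilon^{-2}\rfloor$.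
   Context: $[N]=\{1,\dots,N\}$; $\|\cdot\|$ is the operator norm; $I$ is the identity matrix. For $X\subseteq[km]$, $P_X$ is the diagonal projection onto the coordinates in $X$, where $[km]$ indexes the standard basis of $\mathbb{C}^k\otimes\mathbb{C}^m$. The Fourier matrix is $F_m(a,b)=m^{-1/2}\omega^{(a-1)(b-1)}$ for $a,b\in[m]$, with $\omega=e^{2\pi i/m}$ (here $i$ is the imaginary unit). The cyclic left shift $U$ is the permutation matrix on $\mathbb{C}^k$ shifting the coordinates cyclically by one. A conference matrix $C_m\in M_m(\mathbb{C})$ is a zero diagonal Hermitian matrix such that $C_mC_m^*=(m-1)I$. A tuple $(A^{(1)},\dots,A^{(k)})$ of $N\times N$ matrices can be jointly $(r,\epsilon)$ paved if there is a partition $X_1\amalg\cdots\amalg X_r=[N]$ (pairwise disjoint sets with union $[N]$) with $\|P_{X_i}A^{(j)}P_{X_i}\|<\epsilon$ for all $i\in[r]$, $j\in[k]$.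
   Formalization: A conference matrix is additionally required to have off-diagonal entries of modulus 1 (the usual definition); without this the claim fails, e.g. k=1, m=4, C=√3·P with P the permutation matrix of (12)(34) and blocks {1,3},{2,4}. *)

theory Defs
  imports
    Complex_Main
    "HOL-Library.Disjoint_Sets"
    "Jordan_Normal_Form.Matrix"
    "Jordan_Normal_Form.Schur_Decomposition"
begin

text \<open>
  All indices are 0-based: the coordinates of \<open>\<complex>\<^sup>N\<close> are \<open>{..<N}\<close>, and the basis vector
  \<open>e\<^sub>a \<otimes> e\<^sub>b\<close> of \<open>\<complex>\<^sup>k \<otimes> \<complex>\<^sup>m\<close> is the coordinate \<open>a * m + b\<close> of \<open>\<complex>\<^bsup>k * m\<^esup>\<close>.
  Labels of matrices in a tuple and of blocks in a partition are still 1-based.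
\<close>

definition l2_norm :: "complex vec \<Rightarrow> real" where
  "l2_norm v = sqrt (\<Sum>i<dim_vec v. (cmod (v $ i))\<^sup>2)"

definition op_norm :: "complex mat \<Rightarrow> real" where
  "op_norm A = (SUP v \<in> {v \<in> carrier_vec (dim_col A). l2_norm v \<le> 1}. l2_norm (A *\<^sub>v v))"

definition coord_proj :: "nat \<Rightarrow> nat set \<Rightarrow> complex mat" where
  "coord_proj N X = mat N N (\<lambda>(a, b). if a = b \<and> a \<in> X then 1 else 0)"

definition kronecker :: "complex mat \<Rightarrow> complex mat \<Rightarrow> complex mat" where
  "kronecker A B = mat (dim_row A * dim_row B) (dim_col A * dim_col B)
     (\<lambda>(a, b). A $$ (a div dim_row B, b div dim_col B) * B $$ (a mod dim_row B, b mod dim_col B))"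

definition fourier_mat :: "nat \<Rightarrow> complex mat" where
  "fourier_mat m = mat m m
     (\<lambda>(a, b). exp (2 * complex_of_real pi * \<i> / of_nat m) ^ (a * b) / complex_of_real (sqrt (real m)))"

text \<open>\<open>(U x)\<^sub>a = x\<^bsub>a+1\<^esub>\<close>, with indices modulo \<open>k\<close>.\<close>

definition left_shift :: "nat \<Rightarrow> complex mat" where
  "left_shift k = mat k k (\<lambda>(a, b). if b = (a + 1) mod k then 1 else 0)"

text \<open>
  The unimodularity of the off-diagonal entries is part of the usual notion of a complex
  conference matrix and does not follow from the other conditions: for a fixed-point-free
  involution \<open>\<pi>\<close> of 4 points with permutation matrix \<open>P\<close>, the matrix \<open>\<surd>3 P\<close> is Hermitian
  with zero diagonal and satisfies \<open>C C\<^sup>* = 3 I\<close>.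
\<close>

definition conference_matrix :: "nat \<Rightarrow> complex mat \<Rightarrow> bool" where
  "conference_matrix m C \<longleftrightarrow>
     C \<in> carrier_mat m m \<and>
     (\<forall>a<m. C $$ (a, a) = 0) \<and>
     (\<forall>a<m. \<forall>b<m. a \<noteq> b \<longrightarrow> cmod (C $$ (a, b)) = 1) \<and>
     mat_adjoint C = C \<and>
     C * mat_adjoint C = (of_nat m - 1) \<cdot>\<^sub>m 1\<^sub>m m"

text \<open>Blocks of a partition may be empty.\<close>

definition set_partition :: "nat \<Rightarrow> nat \<Rightarrow> (nat \<Rightarrow> nat set) \<Rightarrow> bool" where
  "set_partition N r X \<longleftrightarrow> disjoint_family_on X {1..r} \<and> (\<Union>i\<in>{1..r}. X i) = {..<N}"

definition paves :: "nat \<Rightarrow> nat \<Rightarrow> (nat \<Rightarrow> complex mat) \<Rightarrow> nat \<Rightarrow> real \<Rightarrow> (nat \<Rightarrow> nat set) \<Rightarrow> bool" where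
  "paves N k A r \<epsilon> X \<longleftrightarrow> set_partition N r X \<and>
     (\<forall>i\<in>{1..r}. \<forall>j\<in>{1..k}. op_norm (coord_proj N (X i) * A j * coord_proj N (X i)) < \<epsilon>)"

definition jointly_pavable :: "nat \<Rightarrow> nat \<Rightarrow> (nat \<Rightarrow> complex mat) \<Rightarrow> nat \<Rightarrow> real \<Rightarrow> bool" where
  "jointly_pavable N k A r \<epsilon> \<longleftrightarrow> (\<exists>X. paves N k A r \<epsilon> X)"

end

theory Submission
  imports Defs
begin

text \<open>
  The operator norm of a matrix dominates the modulus of each of its entries, and compressing by
  \<open>P\<^sub>X\<close> keeps every entry indexed by \<open>X \<times> X\<close>. So a block \<open>X\<close> of an \<open>\<epsilon>\<close>-paving cannot contain
  two coordinates \<open>p \<noteq> q\<close> at which some matrix of the tuple has an entry of modulus at least \<open>\<epsilon>\<close>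
  (lemma \<open>paves_block_unique\<close>).

  The tuple here is built so that every pair \<open>p \<noteq> q\<close> is of this kind. Write \<open>p = (a, b)\<close> and
  \<open>q = (c, d)\<close> in \<open>[k] \<times> [m]\<close>. If \<open>a \<noteq> c\<close>, then \<open>U\<^sup>j\<close> with \<open>j \<equiv> c - a\<close> modulo \<open>k\<close> has entry \<open>1\<close> at
  \<open>(a, c)\<close>, so \<open>U\<^sup>j \<otimes> F\<^sub>m\<close> has an entry of the Fourier matrix, of modulus \<open>1 / \<surd>m\<close>, at \<open>(p, q)\<close>.
  If \<open>a = c\<close>, then \<open>b \<noteq> d\<close>, and the last matrix has a rescaled off-diagonal entry of \<open>C\<^sub>m\<close> there, of
  modulus \<open>1 / \<surd>(m - 1) \<ge> 1 / \<surd>m\<close>. Finally \<open>m \<le> \<epsilon>\<^bsup>-2\<^esup>\<close> says exactly that \<open>1 / \<surd>m \<ge> \<epsilon>\<close>.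

  Hence every block has at most one element. Empty blocks, which joint pavability allows, only
  increase the count, so covering \<open>k * m\<close> coordinates takes at least \<open>k * m\<close> blocks.
\<close>

text \<open>
  The operator norm is a supremum of reals, which is meaningful only because the image of the
  unit ball is bounded; a crude bound by row sums suffices.
\<close>

lemma bdd_above_op_norm:
  "bdd_above ((\<lambda>v. l2_norm (B *\<^sub>v v)) ` {v \<in> carrier_vec (dim_col B). l2_norm v \<le> 1})"
proof (rule bdd_aboveI2)
  fix v assume "v \<in> {v \<in> carrier_vec (dim_col B). l2_norm v \<le> 1}"
  then have v: "dim_vec v = dim_col B" and n: "l2_norm v \<le> 1" by auto
  have le1: "cmod (v $ j) \<le> 1" if "j < dim_col B" for j
  proof -
    have "(cmod (v $ j))\<^sup>2 \<le> (\<Sum>i<dim_vec v. (cmod (v $ i))\<^sup>2)"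
      by (rule member_le_sum) (use that v in auto)
    also have "\<dots> \<le> 1" using n by (simp add: l2_norm_def)
    finally show ?thesis by (simp add: power_le_one_iff abs_square_le_1)
  qed
  have row_le: "cmod ((B *\<^sub>v v) $ i) \<le> (\<Sum>j<dim_col B. cmod (B $$ (i, j)))" if "i < dim_row B" for i
  proof -
    have "(B *\<^sub>v v) $ i = (\<Sum>j<dim_col B. B $$ (i, j) * v $ j)"
      using that v by (simp add: scalar_prod_def atLeast0LessThan)
    also have "cmod \<dots> \<le> (\<Sum>j<dim_col B. cmod (B $$ (i, j) * v $ j))"
      by (rule norm_sum)
    also have "\<dots> \<le> (\<Sum>j<dim_col B. cmod (B $$ (i, j)))"
      by (rule sum_mono) (use le1 in \<open>auto simp: norm_mult intro: mult_left_le\<close>)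
    finally show ?thesis .
  qed
  show "l2_norm (B *\<^sub>v v) \<le> sqrt (\<Sum>i<dim_row B. (\<Sum>j<dim_col B. cmod (B $$ (i, j)))\<^sup>2)"
    unfolding l2_norm_def
    by (auto intro!: sum_mono power_mono row_le simp del: index_mult_mat_vec)
qed

text \<open>Test the supremum on the basis vector \<open>e\<^sub>q\<close>.\<close>

lemma cmod_entry_le_op_norm:
  assumes p: "p < dim_row B" and q: "q < dim_col B"
  shows "cmod (B $$ (p, q)) \<le> op_norm B"
proof -
  let ?e = "unit_vec (dim_col B) q :: complex vec"
  have "(\<Sum>i<dim_col B. (cmod (?e $ i))\<^sup>2) = (\<Sum>i<dim_col B. if i = q then 1 else 0)"
    by (rule sum.cong) (use q in auto)
  then have "l2_norm ?e \<le> 1" using q by (simp add: l2_norm_def)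
  then have "l2_norm (B *\<^sub>v ?e) \<le> op_norm B"
    unfolding op_norm_def by (intro cSUP_upper bdd_above_op_norm) auto
  moreover have "cmod (B $$ (p, q)) \<le> l2_norm (B *\<^sub>v ?e)"
  proof -
    have "(B *\<^sub>v ?e) $ p = B $$ (p, q)"
      using p q by simp
    moreover have "(cmod ((B *\<^sub>v ?e) $ p))\<^sup>2 \<le> (\<Sum>i<dim_vec (B *\<^sub>v ?e). (cmod ((B *\<^sub>v ?e) $ i))\<^sup>2)"
      by (rule member_le_sum) (use p in auto)
    ultimately show ?thesis
      unfolding l2_norm_def by (simp add: real_le_rsqrt)
  qed
  ultimately show ?thesis by simp
qed

lemma coord_proj_carrier: "coord_proj N X \<in> carrier_mat N N"
  by (simp add: coord_proj_def)

lemma coord_proj_mult_entry: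
  assumes M: "M \<in> carrier_mat N N" and p: "p < N" "p \<in> X" and q: "q < N"
  shows "(coord_proj N X * M) $$ (p, q) = M $$ (p, q)"
proof -
  have "(coord_proj N X * M) $$ (p, q) = (\<Sum>i<N. (if p = i then 1 else 0) * M $$ (i, q))"
    using M p q by (simp add: coord_proj_def scalar_prod_def atLeast0LessThan)
  also have "\<dots> = (\<Sum>i<N. if p = i then M $$ (i, q) else 0)"
    by (rule sum.cong) auto
  finally show ?thesis using p by simp
qed

lemma mult_coord_proj_entry:
  assumes M: "M \<in> carrier_mat N N" and p: "p < N" and q: "q < N" "q \<in> X"
  shows "(M * coord_proj N X) $$ (p, q) = M $$ (p, q)"
proof -
  have "(M * coord_proj N X) $$ (p, q) = (\<Sum>i<N. M $$ (p, i) * coord_proj N X $$ (i, q))"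
    using M p q by (simp add: coord_proj_def scalar_prod_def atLeast0LessThan)
  also have "\<dots> = (\<Sum>i<N. if i = q then M $$ (p, i) else 0)"
    by (rule sum.cong) (use q in \<open>auto simp: coord_proj_def\<close>)
  finally show ?thesis using q by simp
qed

lemma compression_entry:
  assumes M: "M \<in> carrier_mat N N" and p: "p < N" "p \<in> X" and q: "q < N" "q \<in> X"
  shows "(coord_proj N X * M * coord_proj N X) $$ (p, q) = M $$ (p, q)"
  using mult_coord_proj_entry[OF mult_carrier_mat[OF coord_proj_carrier M] p(1) q]
    coord_proj_mult_entry[OF M p q(1)] by (rule trans)

lemma paves_block_unique:
  assumes pav: "paves N k A r \<epsilon> X"
    and i: "i \<in> {1..r}" and pq: "p \<in> X i" "q \<in> X i"
    and carrier: "\<And>j. j \<in> {1..k} \<Longrightarrow> A j \<in> carrier_mat N N"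
    and large: "\<And>p q. p < N \<Longrightarrow> q < N \<Longrightarrow> p \<noteq> q \<Longrightarrow> \<exists>j\<in>{1..k}. \<epsilon> \<le> cmod (A j $$ (p, q))"
  shows "p = q"
proof (rule ccontr)
  assume "p \<noteq> q"
  have lt: "p < N" "q < N"
    using pav i pq by (auto simp: paves_def set_partition_def)
  then obtain j where j: "j \<in> {1..k}" and big: "\<epsilon> \<le> cmod (A j $$ (p, q))"
    using large \<open>p \<noteq> q\<close> by blast
  let ?B = "coord_proj N (X i) * A j * coord_proj N (X i)"
  have "cmod (?B $$ (p, q)) \<le> op_norm ?B"
    by (rule cmod_entry_le_op_norm) (use lt in \<open>simp_all add: coord_proj_def\<close>)
  moreover have "op_norm ?B < \<epsilon>"
    using pav i j by (auto simp: paves_def)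
  moreover have "?B $$ (p, q) = A j $$ (p, q)"
    by (rule compression_entry) (use carrier j lt pq in auto)
  ultimately show False using big by simp
qed

lemma set_partition_card_le:
  assumes part: "set_partition N r X"
    and unique: "\<And>i p q. i \<in> {1..r} \<Longrightarrow> p \<in> X i \<Longrightarrow> q \<in> X i \<Longrightarrow> p = q"
  shows "N \<le> r"
proof -
  have "N = card (\<Union>i\<in>{1..r}. X i)" using part by (simp add: set_partition_def)
  also have "\<dots> \<le> (\<Sum>i\<in>{1..r}. card (X i))" by (rule card_UN_le) simp
  also have "\<dots> \<le> (\<Sum>i\<in>{1..r}. 1)"
  proof (rule sum_mono)
    fix i assume i: "i \<in> {1..r}"
    then have "X i \<subseteq> {..<N}" using part by (auto simp: set_partition_def)
    then have "finite (X i)" by (rule finite_subset) simp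
    then show "card (X i) \<le> 1" using unique[OF i] by (simp add: card_le_Suc0_iff_eq)
  qed
  finally show ?thesis by simp
qed

lemma left_shift_pow_carrier: "left_shift k ^\<^sub>m j \<in> carrier_mat k k"
  by (rule pow_carrier_mat) (simp add: left_shift_def)

lemma left_shift_pow_entry:
  assumes "a < k" "b < k"
  shows "(left_shift k ^\<^sub>m j) $$ (a, b) = (if b = (a + j) mod k then 1 else 0)"
  using assms
proof (induction j arbitrary: a b)
  case 0
  then show ?case by (auto simp: left_shift_def)
next
  case (Suc j)
  have "(left_shift k ^\<^sub>m Suc j) $$ (a, b)
      = (\<Sum>c<k. (left_shift k ^\<^sub>m j) $$ (a, c) * left_shift k $$ (c, b))"
    using Suc.prems left_shift_pow_carrier[of k j]
    by (simp add: scalar_prod_def atLeast0LessThan left_shift_def)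
  also have "\<dots> = (\<Sum>c<k. if c = (a + j) mod k then (if b = (c + 1) mod k then 1 else 0) else 0)"
    by (rule sum.cong) (use Suc in \<open>auto simp: left_shift_def\<close>)
  also have "\<dots> = (if b = ((a + j) mod k + 1) mod k then 1 else 0)"
    using Suc.prems by (subst sum.delta) auto
  finally show ?case by (simp add: mod_Suc_eq)
qed

lemma left_shift_pow_connects:
  fixes a c k :: nat
  assumes "a < k" "c < k" "a \<noteq> c"
  obtains j where "j \<in> {1..<k}" "(left_shift k ^\<^sub>m j) $$ (a, c) = 1"
proof (cases "a < c")
  case True
  with assms have "c - a \<in> {1..<k}" "(a + (c - a)) mod k = c" by auto
  then show ?thesis using that assms left_shift_pow_entry by metis
next
  case False
  with assms have "c + k - a \<in> {1..<k}" "(a + (c + k - a)) mod k = c" by auto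
  then show ?thesis using that assms left_shift_pow_entry by metis
qed

lemma cmod_fourier_entry:
  assumes "b < m" "d < m"
  shows "cmod (fourier_mat m $$ (b, d)) = 1 / sqrt (real m)"
proof -
  have "cmod (exp (2 * complex_of_real pi * \<i> / of_nat m)) = 1"
    by (simp add: norm_exp_eq_Re)
  then show ?thesis
    using assms by (simp add: fourier_mat_def norm_divide norm_power)
qed

lemma kronecker_carrier:
  assumes "P \<in> carrier_mat k k" "Q \<in> carrier_mat m m"
  shows "kronecker P Q \<in> carrier_mat (k * m) (k * m)"
  using assms by (auto simp: kronecker_def)

lemma kronecker_entry:
  assumes "P \<in> carrier_mat k k" "Q \<in> carrier_mat m m" "p < k * m" "q < k * m"
  shows "kronecker P Q $$ (p, q) = P $$ (p div m, q div m) * Q $$ (p mod m, q mod m)"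
  using assms by (simp add: kronecker_def)

theorem proposition30:
  fixes k m :: nat and \<epsilon> :: real and C :: "complex mat" and A :: "nat \<Rightarrow> complex mat"
  assumes "k \<ge> 1"
    and "0 < \<epsilon>" and "\<epsilon> < 1"
    and "int m = \<lfloor>\<epsilon> powi (-2)\<rfloor>"
    and "m \<ge> 2"
    and "conference_matrix m C"
    and "\<And>j. j \<in> {1..<k} \<Longrightarrow> A j = kronecker (left_shift k ^\<^sub>m j) (fourier_mat m)"
    and "A k = complex_of_real (1 / sqrt (real m - 1)) \<cdot>\<^sub>m kronecker (1\<^sub>m k) C"
  shows "(\<forall>r X. paves (k * m) k A r \<epsilon> X \<and> (\<forall>i\<in>{1..r}. X i \<noteq> {})
            \<longrightarrow> (\<forall>i\<in>{1..r}. is_singleton (X i)))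
       \<and> (\<forall>r. jointly_pavable (k * m) k A r \<epsilon> \<longrightarrow> int r \<ge> int k * \<lfloor>\<epsilon> powi (-2)\<rfloor>)"
proof -
  note A_shift = assms(7) and A_conf = assms(8)
  have C: "C \<in> carrier_mat m m"
    and C_entry: "\<And>b d. b < m \<Longrightarrow> d < m \<Longrightarrow> b \<noteq> d \<Longrightarrow> cmod (C $$ (b, d)) = 1"
    using assms(6) by (auto simp: conference_matrix_def)
  have F: "fourier_mat m \<in> carrier_mat m m" by (simp add: fourier_mat_def)
  have eps_le: "\<epsilon> \<le> 1 / sqrt (real m)"
  proof -
    have "real m \<le> \<epsilon> powi (-2)" using assms(4) by linarith
    then have "real m * \<epsilon>\<^sup>2 \<le> 1"
      using assms(2) by (simp add: power_int_minus field_simps)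
    then have "sqrt (real m * \<epsilon>\<^sup>2) \<le> 1" by simp
    then show ?thesis
      using assms(2,5) by (simp add: real_sqrt_mult field_simps)
  qed
  have carrier: "A j \<in> carrier_mat (k * m) (k * m)" if "j \<in> {1..k}" for j
  proof (cases "j = k")
    case True
    then show ?thesis using A_conf kronecker_carrier[OF one_carrier_mat C, of k] by simp
  next
    case False
    then show ?thesis
      using that A_shift[of j] kronecker_carrier[OF left_shift_pow_carrier F] by simp
  qed
  have large: "\<exists>j\<in>{1..k}. \<epsilon> \<le> cmod (A j $$ (p, q))"
    if p: "p < k * m" and q: "q < k * m" and ne: "p \<noteq> q" for p q
  proof -
    have div: "p div m < k" "q div m < k"
      using p q by (simp_all add: less_mult_imp_div_less)
    have md: "p mod m < m" "q mod m < m" using assms(5) by simp_all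
    show ?thesis
    proof (cases "p div m = q div m")
      case True
      then have "p mod m \<noteq> q mod m" using ne by (metis div_mult_mod_eq)
      then have "cmod (A k $$ (p, q)) = 1 / sqrt (real m - 1)"
        using p q div md True assms(5) C_entry kronecker_carrier[OF one_carrier_mat C, of k]
        by (simp add: A_conf kronecker_entry[OF one_carrier_mat C] norm_mult norm_divide
            del: of_real_divide)
      moreover have "1 / sqrt (real m) \<le> 1 / sqrt (real m - 1)"
        using assms(5) by (intro divide_left_mono) auto
      ultimately show ?thesis using eps_le assms(1) by (intro bexI[of _ k]) auto
    next
      case False
      then obtain j where j: "j \<in> {1..<k}"
        and one: "(left_shift k ^\<^sub>m j) $$ (p div m, q div m) = 1"
        using left_shift_pow_connects div by metis
      have "A j $$ (p, q) = fourier_mat m $$ (p mod m, q mod m)"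
        using A_shift[OF j] kronecker_entry[OF left_shift_pow_carrier F p q] one by simp
      then have "cmod (A j $$ (p, q)) = 1 / sqrt (real m)"
        using cmod_fourier_entry md by simp
      then show ?thesis using eps_le j by (intro bexI[of _ j]) auto
    qed
  qed
  have unique: "p = q"
    if "paves (k * m) k A r \<epsilon> X" "i \<in> {1..r}" "p \<in> X i" "q \<in> X i" for r X i p q
    using paves_block_unique[OF that carrier large] .
  show ?thesis
  proof (intro conjI allI impI ballI)
    fix r X i
    assume "paves (k * m) k A r \<epsilon> X \<and> (\<forall>i\<in>{1..r}. X i \<noteq> {})" and "i \<in> {1..r}"
    then show "is_singleton (X i)"
      using unique by (meson ex_in_conv is_singletonI')
  next
    fix r
    assume "jointly_pavable (k * m) k A r \<epsilon>"
    then obtain X where X: "paves (k * m) k A r \<epsilon> X"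
      by (auto simp: jointly_pavable_def)
    have "k * m \<le> r"
    proof (rule set_partition_card_le)
      show "set_partition (k * m) r X" using X by (simp add: paves_def)
    qed (rule unique[OF X])
    then show "int k * \<lfloor>\<epsilon> powi (-2)\<rfloor> \<le> int r"
      unfolding assms(4)[symmetric] by (simp flip: of_nat_mult)
  qed
qed

end
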